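(* For $m=1,\dots,N$ let $r^{\max}_m=\max\{r_{i\mathcal c}: |\mathcal c|=m,\ i\in \mathcal c\}$ and $r^{\min}_m=\min\{r_{i\mathcal c}: |\mathcal c|=m,\ i\in \mathcal c\}$, assumed positive. If $$\frac{1}{r^{\min}_{m}}+\frac{1}{r^{\min}_{m-2}}\le\frac{2}{r^{\max}_{m-1}}\qquad\text{for all } m=2,\dots,N,$$ where the term $1/r^{\min}_0$ (occurring for $m=2$) is taken to be $0$, then the all-at-once strategy $\mathcal H^N$ is optimal.
   Context: $\mathcal N=\{1,\dots,N\}$ is a set of links with strictly positive demands $d_1,\dots,d_N$ (queue contents). $\mathcal H$ is the set of all nonempty subsets of $\mathcal N$, called groups. For each group $\mathcal c$ and link $i$, $r_{i\mathcal c}\ge 0$ is the service rate of link $i$ when $\mathcal c$ is active, with $r_{i\mathcal c}=0$ for $i\notin \mathcal c$. Rate monotonicity holds: if $\mathcal c_1\subset \mathcal c_2$ and $i\in \mathcal c_1$, then $r_{i\mathcal c_1}\ge r_{i\mathcal c_2}$. A schedule is a vector $T=(T_{\mathcal c})_{\mathcal c\in\mathcal H}\ge 0$ with $\sum_{\mathcal c\in\mathcal H}r_{i\mathcal c}T_{\mathcal c}=d_i$ for every $i$; its length is $\sum_{\mathcal c}T_{\mathcal c}$; it is optimal if its length is minimum. The strategy $\mathcal H^N$: activate the group of all links until some queue becomes empty; the next group consists of all links with positive remaining demand, activated until some queue becomes empty; and so on until all queues are empty. *)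

theory Defs
  imports "HOL-Analysis.Analysis"
begin

definition groups :: "nat \<Rightarrow> nat set set" where
  "groups N = {c. c \<subseteq> {1..N} \<and> c \<noteq> {}}"

definition valid_rates :: "nat \<Rightarrow> (nat \<Rightarrow> nat set \<Rightarrow> real) \<Rightarrow> bool" where
  "valid_rates N r \<longleftrightarrow>
     (\<forall>c\<in>groups N. \<forall>i\<in>{1..N}. 0 \<le> r i c) \<and>
     (\<forall>c\<in>groups N. \<forall>i\<in>{1..N}. i \<notin> c \<longrightarrow> r i c = 0)"

definition rate_monotone :: "nat \<Rightarrow> (nat \<Rightarrow> nat set \<Rightarrow> real) \<Rightarrow> bool" where
  "rate_monotone N r \<longleftrightarrow>
     (\<forall>c1\<in>groups N. \<forall>c2\<in>groups N. \<forall>i\<in>c1. c1 \<subset> c2 \<longrightarrow> r i c2 \<le> r i c1)"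

definition is_schedule ::
  "nat \<Rightarrow> (nat \<Rightarrow> nat set \<Rightarrow> real) \<Rightarrow> (nat \<Rightarrow> real) \<Rightarrow> (nat set \<Rightarrow> real) \<Rightarrow> bool" where
  "is_schedule N r d T \<longleftrightarrow>
     (\<forall>c\<in>groups N. 0 \<le> T c) \<and>
     (\<forall>i\<in>{1..N}. (\<Sum>c\<in>groups N. r i c * T c) = d i)"

definition sched_length :: "nat \<Rightarrow> (nat set \<Rightarrow> real) \<Rightarrow> real" where
  "sched_length N T = (\<Sum>c\<in>groups N. T c)"

definition optimal_schedule ::
  "nat \<Rightarrow> (nat \<Rightarrow> nat set \<Rightarrow> real) \<Rightarrow> (nat \<Rightarrow> real) \<Rightarrow> (nat set \<Rightarrow> real) \<Rightarrow> bool" where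
  "optimal_schedule N r d T \<longleftrightarrow>
     is_schedule N r d T \<and>
     (\<forall>T'. is_schedule N r d T' \<longrightarrow> sched_length N T \<le> sched_length N T')"

definition backlogged :: "nat \<Rightarrow> (nat \<Rightarrow> real) \<Rightarrow> nat set" where
  "backlogged N q = {i\<in>{1..N}. 0 < q i}"

text \<open>The first time at which some queue of the active group \<open>c\<close>, started from contents \<open>q\<close>,
  becomes empty. The infimum is attained whenever some link of \<open>c\<close> has positive rate; it is
  not meaningful (infimum of the empty set) if all rates in \<open>c\<close> vanish.\<close>

definition emptying_time :: "(nat \<Rightarrow> nat set \<Rightarrow> real) \<Rightarrow> nat set \<Rightarrow> (nat \<Rightarrow> real) \<Rightarrow> real" where
  "emptying_time r c q = Inf {t. 0 \<le> t \<and> (\<exists>i\<in>c. q i - r i c * t = 0)}"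

text \<open>Remaining demands after \<open>k\<close> phases of the all-at-once strategy; once all queues are
  empty the strategy has stopped and nothing changes any more.\<close>

primrec remaining ::
  "nat \<Rightarrow> (nat \<Rightarrow> nat set \<Rightarrow> real) \<Rightarrow> (nat \<Rightarrow> real) \<Rightarrow> nat \<Rightarrow> (nat \<Rightarrow> real)" where
  "remaining N r d 0 = d"
| "remaining N r d (Suc k) =
     (let q = remaining N r d k; c = backlogged N q
      in if c = {} then q else (\<lambda>i. q i - r i c * emptying_time r c q))"

definition phase_group ::
  "nat \<Rightarrow> (nat \<Rightarrow> nat set \<Rightarrow> real) \<Rightarrow> (nat \<Rightarrow> real) \<Rightarrow> nat \<Rightarrow> nat set" where
  "phase_group N r d k = backlogged N (remaining N r d k)"

definition phase_duration ::
  "nat \<Rightarrow> (nat \<Rightarrow> nat set \<Rightarrow> real) \<Rightarrow> (nat \<Rightarrow> real) \<Rightarrow> nat \<Rightarrow> real" where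
  "phase_duration N r d k = emptying_time r (phase_group N r d k) (remaining N r d k)"

text \<open>The total activation time that the strategy gives to each group. When all rates
  \<open>r i c\<close> with \<open>i \<in> c\<close> are positive, each phase empties a queue, so a nonempty group is the
  group of at most one phase and the index set below is finite. On the empty set, which is not
  a group, the value is irrelevant.\<close>

definition all_at_once ::
  "nat \<Rightarrow> (nat \<Rightarrow> nat set \<Rightarrow> real) \<Rightarrow> (nat \<Rightarrow> real) \<Rightarrow> nat set \<Rightarrow> real" where
  "all_at_once N r d c = (\<Sum>k\<in>{k. phase_group N r d k = c}. phase_duration N r d k)"

definition r_max :: "nat \<Rightarrow> (nat \<Rightarrow> nat set \<Rightarrow> real) \<Rightarrow> nat \<Rightarrow> real" where
  "r_max N r m = Max {r i c | i c. c \<in> groups N \<and> card c = m \<and> i \<in> c}"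

definition r_min :: "nat \<Rightarrow> (nat \<Rightarrow> nat set \<Rightarrow> real) \<Rightarrow> nat \<Rightarrow> real" where
  "r_min N r m = Min {r i c | i c. c \<in> groups N \<and> card c = m \<and> i \<in> c}"

end

theory Submission
  imports Defs
begin

text \<open>Linear programming duality. Order the links so that the one emptied last comes first; the
  phase groups of the strategy are then prefixes of this order. Solving the triangular system that
  makes the dual constraint of each prefix tight gives dual weights \<open>v\<close>, which are nonnegative by
  rate monotonicity. The sum \<open>W m\<close> of the first \<open>m\<close> weights lies between \<open>1 / r_max m\<close> and
  \<open>1 / r_min m\<close>, so the hypothesis gives \<open>W (m + 1) + W (m - 1) \<le> 2 / r_max m \<le> 2 * W m\<close>. Hence \<open>W\<close> is
  concave, that is, \<open>v\<close> is decreasing. So a group of size \<open>m\<close> other than a prefix has total weight at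
  most \<open>W (m - 1) + (W (m + 1) - W m) \<le> 1 / r_max m\<close>, and its dual constraint holds.\<close>

subsection \<open>Rates\<close>

lemma finite_groups: "finite (groups N)"
  unfolding groups_def by (rule finite_subset[of _ "Pow {1..N}"]) auto

lemma groups_finite: "c \<in> groups N \<Longrightarrow> finite c"
  unfolding groups_def by (auto intro: finite_subset)

lemma groups_card: "c \<in> groups N \<Longrightarrow> card c \<in> {1..N}"
  using card_mono[of "{1..N}" c] groups_finite[of c N]
  by (auto simp: groups_def Suc_le_eq card_gt_0_iff)

text \<open>The set behind \<open>r_min\<close> and \<open>r_max\<close> is a subset of the image of
  a finite product, so \<open>Min\<close> and \<open>Max\<close> are genuine bounds.\<close>

lemma rate_bounds:
  assumes "c \<in> groups N" "i \<in> c"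
  shows "r_min N r (card c) \<le> r i c" "r i c \<le> r_max N r (card c)"
proof -
  let ?A = "{r i c' | i c'. c' \<in> groups N \<and> card c' = card c \<and> i \<in> c'}"
  have "?A \<subseteq> (\<lambda>(i, c). r i c) ` ({1..N} \<times> groups N)"
    by (auto simp: groups_def image_iff)
  then have fin: "finite ?A"
    by (rule finite_subset) (simp add: finite_groups)
  have "r i c \<in> ?A" using assms by blast
  then show "r_min N r (card c) \<le> r i c" "r i c \<le> r_max N r (card c)"
    unfolding r_min_def r_max_def using fin by (auto intro: Min_le Max_ge)
qed

subsection \<open>Duality\<close>

text \<open>Weak duality with complementary slackness. The demands are met with equality, so
  weighting them by \<open>w\<close> gives the same value for every schedule. This value is a lower
  bound for each length by \<open>le\<close>, and it is the length of \<open>A\<close> by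
  \<open>eq\<close>.\<close>

lemma optimal_scheduleI:
  assumes A: "is_schedule N r d A"
    and le: "\<And>c. c \<in> groups N \<Longrightarrow> (\<Sum>i\<in>{1..N}. w i * r i c) \<le> 1"
    and eq: "\<And>c. c \<in> groups N \<Longrightarrow> A c \<noteq> 0 \<Longrightarrow> (\<Sum>i\<in>{1..N}. w i * r i c) = 1"
  shows "optimal_schedule N r d A"
proof -
  have val: "(\<Sum>c\<in>groups N. (\<Sum>i\<in>{1..N}. w i * r i c) * T c) = (\<Sum>i\<in>{1..N}. w i * d i)"
    if T: "is_schedule N r d T" for T
  proof -
    have "(\<Sum>c\<in>groups N. (\<Sum>i\<in>{1..N}. w i * r i c) * T c)
        = (\<Sum>i\<in>{1..N}. \<Sum>c\<in>groups N. w i * r i c * T c)"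
      by (simp only: sum_distrib_right) (rule sum.swap)
    also have "\<dots> = (\<Sum>i\<in>{1..N}. w i * (\<Sum>c\<in>groups N. r i c * T c))"
      by (simp add: sum_distrib_left mult.assoc)
    also have "\<dots> = (\<Sum>i\<in>{1..N}. w i * d i)"
      using T by (auto simp: is_schedule_def intro!: sum.cong)
    finally show ?thesis .
  qed
  have "sched_length N A \<le> sched_length N T" if T: "is_schedule N r d T" for T
  proof -
    have "sched_length N A = (\<Sum>c\<in>groups N. (\<Sum>i\<in>{1..N}. w i * r i c) * A c)"
      unfolding sched_length_def using eq by (intro sum.cong) auto
    also have "\<dots> = (\<Sum>c\<in>groups N. (\<Sum>i\<in>{1..N}. w i * r i c) * T c)"
      using val[OF A] val[OF T] by simp
    also have "\<dots> \<le> (\<Sum>c\<in>groups N. 1 * T c)"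
      using le T by (intro sum_mono mult_right_mono) (auto simp: is_schedule_def)
    finally show ?thesis by (simp add: sched_length_def)
  qed
  with A show ?thesis unfolding optimal_schedule_def by blast
qed

subsection \<open>Triangular systems\<close>

text \<open>Forward substitution. Unknowns are numbered from 0 while the second index of
  \<open>a\<close> is the size of a prefix, so the diagonal entries are
  \<open>a m (Suc m)\<close>.\<close>

fun triangular_solution :: "(nat \<Rightarrow> nat \<Rightarrow> real) \<Rightarrow> nat \<Rightarrow> real" where
  "triangular_solution a m =
     (1 - (\<Sum>i<m. triangular_solution a i * a i (Suc m))) / a m (Suc m)"

declare triangular_solution.simps [simp del]

lemma triangular_solution_sum:
  assumes "a m (Suc m) \<noteq> 0"
  shows "(\<Sum>i<Suc m. triangular_solution a i * a i (Suc m)) = 1"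
  using assms by (simp add: triangular_solution.simps[of a m])

text \<open>Passing from prefix size \<open>m\<close> to \<open>Suc m\<close> only lowers the
  coefficients of the earlier, nonnegative unknowns. Their total was 1 by the previous equation, so
  the numerator defining the new unknown is nonnegative.\<close>

lemma triangular_solution_nonneg:
  assumes pos: "\<And>m. m < N \<Longrightarrow> 0 < a m (Suc m)"
    and mono: "\<And>i m. i < m \<Longrightarrow> m < N \<Longrightarrow> a i (Suc m) \<le> a i m"
    and "m < N"
  shows "0 \<le> triangular_solution a m"
  using \<open>m < N\<close>
proof (induction m rule: less_induct)
  case (less m)
  have "(\<Sum>i<m. triangular_solution a i * a i (Suc m)) \<le> 1"
  proof (cases m)
    case (Suc l)
    have "(\<Sum>i<m. triangular_solution a i * a i (Suc m)) \<le> (\<Sum>i<m. triangular_solution a i * a i m)"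
      using less by (intro sum_mono mult_left_mono mono) auto
    also have "\<dots> = 1"
      using triangular_solution_sum[of a l] pos[of l] less.prems Suc by auto
    finally show ?thesis .
  qed simp
  with pos[OF less.prems] show ?case
    by (simp add: triangular_solution.simps[of a m])
qed

subsection \<open>Sums of the largest weights\<close>

text \<open>Induction on \<open>N\<close>: if the largest index \<open>N\<close> lies in
  \<open>J\<close>, it is traded for \<open>card J - 1\<close>, whose weight is at least as
  large.\<close>

lemma sum_le_sum_prefix:
  fixes v :: "nat \<Rightarrow> real"
  assumes "\<And>i j. i \<le> j \<Longrightarrow> j < N \<Longrightarrow> v j \<le> v i" and "J \<subseteq> {..<N}"
  shows "sum v J \<le> sum v {..<card J}"
  using assms
proof (induction N arbitrary: J)
  case (Suc N)
  show ?case
  proof (cases "N \<in> J")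
    case True
    have fin: "finite J" using Suc.prems(2) finite_subset by blast
    then have J: "card J = Suc (card (J - {N}))"
      using True by (metis card_Suc_Diff1)
    have "card J \<le> Suc N" using card_mono[OF _ Suc.prems(2)] by simp
    then have "v N \<le> v (card (J - {N}))" using J by (intro Suc.prems(1)) auto
    moreover have "sum v (J - {N}) \<le> sum v {..<card (J - {N})}"
      using Suc.prems by (intro Suc.IH) (auto simp: less_Suc_eq)
    ultimately show ?thesis
      using J sum.remove[OF fin True, of v] by simp
  next
    case False
    then show ?thesis using Suc.prems by (intro Suc.IH) (auto simp: less_Suc_eq)
  qed
qed simp

text \<open>Some element of \<open>J\<close> is at least \<open>card J\<close> and so weighs at most
  \<open>v (card J)\<close>; the other \<open>card J - 1\<close> elements weigh at most the prefix
  of that size.\<close>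

lemma sum_le_if_not_prefix:
  fixes v :: "nat \<Rightarrow> real"
  assumes anti: "\<And>i j. i \<le> j \<Longrightarrow> j < N \<Longrightarrow> v j \<le> v i" and J: "J \<subseteq> {..<N}"
    and ne: "J \<noteq> {..<card J}"
  shows "sum v J \<le> sum v {..<card J - 1} + v (card J)"
proof -
  have fin: "finite J" using J finite_subset by blast
  have "\<not> J \<subseteq> {..<card J}" using ne card_subset_eq[of "{..<card J}" J] by auto
  then obtain e where e: "e \<in> J" "card J \<le> e" by force
  have "v e \<le> v (card J)" using e J by (intro anti) auto
  moreover have "sum v (J - {e}) \<le> sum v {..<card (J - {e})}"
    using J by (intro sum_le_sum_prefix[of N] anti) auto
  ultimately show ?thesis
    using sum.remove[OF fin e(1), of v] fin e by simp
qed

subsection \<open>Dual feasibility\<close>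

text \<open>The enumeration \<open>p\<close> is arbitrary here: the bounds on rates depend on group
  sizes only, and prefixes of any enumeration are nested. It is chosen later so that the phase
  groups are among its prefixes.\<close>

lemma dual_weights:
  assumes valid: "valid_rates N r" and mono: "rate_monotone N r"
    and pos: "\<forall>m\<in>{1..N}. 0 < r_max N r m \<and> 0 < r_min N r m"
    and cond: "\<forall>m\<in>{2..N}. 1 / r_min N r m + (if m = 2 then 0 else 1 / r_min N r (m - 2))
                     \<le> 2 / r_max N r (m - 1)"
    and p: "bij_betw p {..<N} {1..N}"
  obtains w where "\<And>c. c \<in> groups N \<Longrightarrow> (\<Sum>i\<in>{1..N}. w i * r i c) \<le> 1"
    and "\<And>m. m \<in> {1..N} \<Longrightarrow> (\<Sum>i\<in>{1..N}. w i * r i (p ` {..<m})) = 1"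
proof -
  define g where "g m = p ` {..<m}" for m
  define a where "a i m = r (p i) (g m)" for i m
  define v where "v = triangular_solution a"
  define W where "W m = sum v {..<m}" for m
  define w where "w i = v (inv_into {..<N} p i)" for i
  have inj: "inj_on p {..<N}" and img: "p ` {..<N} = {1..N}"
    using p by (auto simp: bij_betw_def)
  have g: "g m \<in> groups N" "card (g m) = m" if "m \<in> {1..N}" for m
  proof -
    have "g m \<subseteq> {1..N}" unfolding g_def img[symmetric] using that by (intro image_mono) auto
    then show "g m \<in> groups N" using that by (auto simp: groups_def g_def lessThan_empty_iff)
    have "inj_on p {..<m}" using inj that by (auto intro: inj_on_subset)
    then show "card (g m) = m" unfolding g_def by (simp add: card_image)
  qed
  have a_bounds: "r_min N r m \<le> a i m" "a i m \<le> r_max N r m" if "i < m" "m \<le> N" for i m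
    using rate_bounds[of "g m" N "p i" r] g[of m] that by (auto simp: a_def g_def)
  have a_pos: "0 < a m (Suc m)" if "m < N" for m
    using a_bounds(1)[of m "Suc m"] pos[rule_format, of "Suc m"] that by auto
  have a_mono: "a i (Suc m) \<le> a i m" if "i < m" "m < N" for i m
  proof -
    have "g m \<subset> g (Suc m)"
    proof
      show "g m \<subseteq> g (Suc m)" unfolding g_def by (intro image_mono) auto
      show "g m \<noteq> g (Suc m)" using g(2)[of m] g(2)[of "Suc m"] that by force
    qed
    then show ?thesis
      using mono that g(1)[of m] g(1)[of "Suc m"]
      unfolding rate_monotone_def a_def by (auto simp: g_def)
  qed
  have v_nonneg: "0 \<le> v m" if "m < N" for m
    unfolding v_def using a_pos a_mono that by (rule triangular_solution_nonneg)
  have tight: "(\<Sum>i<m. v i * a i m) = 1" if "m \<in> {1..N}" for m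
    using that triangular_solution_sum[of a "m - 1"] a_pos[of "m - 1"] unfolding v_def
    by (cases m) auto
  have W_bounds: "1 / r_max N r m \<le> W m" "W m \<le> 1 / r_min N r m" if m: "m \<in> {1..N}" for m
  proof -
    have "1 \<le> (\<Sum>i<m. v i * r_max N r m)"
      unfolding tight[OF m, symmetric] using m
      by (intro sum_mono mult_left_mono a_bounds v_nonneg) auto
    then show "1 / r_max N r m \<le> W m"
      using pos m by (simp add: W_def sum_distrib_right divide_simps)
    have "(\<Sum>i<m. v i * r_min N r m) \<le> 1"
      unfolding tight[OF m, symmetric] using m
      by (intro sum_mono mult_left_mono a_bounds v_nonneg) auto
    then show "W m \<le> 1 / r_min N r m"
      using pos m by (simp add: W_def sum_distrib_right divide_simps)
  qed
  have W_Suc: "W (Suc m) = W m + v m" for m by (simp add: W_def)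
  \<comment> \<open>This is the hypothesis at \<open>Suc m\<close>, with both sums bounded by
    \<open>1 / r_min\<close>. For \<open>m = 1\<close> the value \<open>W 0 = 0\<close> matches the
    convention for the missing term.\<close>
  have W_conc: "W (Suc m) + W (m - 1) \<le> 2 / r_max N r m" if "1 \<le> m" "m < N" for m
  proof (cases "m = 1")
    case True
    then show ?thesis using cond[rule_format, of 2] W_bounds(2)[of 2] that
      by (simp add: W_def numeral_2_eq_2)
  next
    case False
    then have "m - 1 \<in> {1..N}" "Suc m \<in> {1..N}" using that by auto
    then show ?thesis
      using cond[rule_format, of "Suc m"] W_bounds(2)[of "Suc m"] W_bounds(2)[of "m - 1"] that False
      by simp
  qed
  \<comment> \<open>Subtracting \<open>W m\<close>, which is at least
    \<open>1 / r_max N r m\<close>, from the previous bound gives the first claim. The second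
    follows since \<open>W m\<close> is \<open>W (m - 1) + v (m - 1)\<close>.\<close>
  have v_step: "v m + W (m - 1) \<le> 1 / r_max N r m" "v m \<le> v (m - 1)" if "1 \<le> m" "m < N" for m
  proof -
    show "v m + W (m - 1) \<le> 1 / r_max N r m"
      using W_conc[OF that] W_bounds(1)[of m] W_Suc[of m] that by simp
    then show "v m \<le> v (m - 1)"
      using W_bounds(1)[of m] W_Suc[of "m - 1"] that by simp
  qed
  have v_anti: "v j \<le> v i" if "i \<le> j" "j < N" for i j
    using that
  proof (induction j rule: dec_induct)
    case (step j)
    then show ?case using v_step(2)[of "Suc j"] by simp
  qed simp
  have reindex: "(\<Sum>i\<in>{1..N}. w i * r i c) = (\<Sum>j<N. v j * r (p j) c)" for c
    unfolding sum.reindex_bij_betw[OF p, symmetric] using inj by (intro sum.cong) (auto simp: w_def)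
  have prefix: "(\<Sum>i\<in>{1..N}. w i * r i (g m)) = 1" if m: "m \<in> {1..N}" for m
  proof -
    have "r (p j) (g m) = 0" if j: "j \<in> {..<N} - {..<m}" for j
    proof -
      have "p j \<notin> g m" using inj j m unfolding g_def
        by (subst inj_on_image_mem_iff[of p "{..<N}"]) auto
      moreover have "p j \<in> {1..N}" using img j by blast
      ultimately show ?thesis using valid g(1)[OF m] unfolding valid_rates_def by blast
    qed
    then have "(\<Sum>j<N. v j * r (p j) (g m)) = (\<Sum>j<m. v j * r (p j) (g m))"
      using m by (intro sum.mono_neutral_right) auto
    then show ?thesis using tight[OF m] unfolding reindex a_def by simp
  qed
  have "(\<Sum>i\<in>{1..N}. w i * r i c) \<le> 1" if c: "c \<in> groups N" for c
  proof -
    define J where "J = {j. j < N \<and> p j \<in> c}"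
    have J: "J \<subseteq> {..<N}" "p ` J = c"
      using c unfolding groups_def img[symmetric] J_def by blast+
    have card: "card J = card c" using card_image[OF inj_on_subset[OF inj J(1)]] J(2) by simp
    have m: "card c \<in> {1..N}" by (rule groups_card[OF c])
    show ?thesis
    proof (cases "J = {..<card J}")
      case True
      then have "c = g (card c)" using J(2) card by (simp add: g_def)
      then show ?thesis using prefix[OF m] by simp
    next
      case False
      \<comment> \<open>The set of all ranks is itself a prefix. Hence \<open>card c < N\<close>, so
        that \<open>v_step\<close> applies at \<open>card c\<close>.\<close>
      have "card J \<noteq> N" using False J(1) card_subset_eq[of "{..<N}" J] by auto
      then have less: "card c < N" using card m by auto
      have "(\<Sum>j<N. v j * r (p j) c) = (\<Sum>j\<in>J. v j * r (p j) c)"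
      proof (intro sum.mono_neutral_right ballI)
        fix j assume "j \<in> {..<N} - J"
        then have "p j \<in> {1..N}" "p j \<notin> c" using img by (auto simp: J_def)
        then show "v j * r (p j) c = 0" using valid c unfolding valid_rates_def by simp
      qed (use J in auto)
      also have "\<dots> \<le> (\<Sum>j\<in>J. v j * r_max N r (card c))"
        using J c by (intro sum_mono mult_left_mono rate_bounds v_nonneg) (auto simp: J_def)
      also have "\<dots> = sum v J * r_max N r (card c)" by (simp add: sum_distrib_right)
      also have "\<dots> \<le> 1 / r_max N r (card c) * r_max N r (card c)"
      proof (rule mult_right_mono)
        have "sum v J \<le> W (card c - 1) + v (card c)"
          using sum_le_if_not_prefix[of N v, OF v_anti J(1) False] card by (simp add: W_def)
        also have "\<dots> \<le> 1 / r_max N r (card c)" using v_step(1)[of "card c"] m less by simp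
        finally show "sum v J \<le> 1 / r_max N r (card c)" .
        show "0 \<le> r_max N r (card c)" using pos[rule_format, OF m] by simp
      qed
      also have "\<dots> = 1" using pos[rule_format, OF m] by simp
      finally show ?thesis unfolding reindex .
    qed
  qed
  with prefix show ?thesis using that unfolding g_def by blast
qed

subsection \<open>The all-at-once strategy\<close>

text \<open>With positive rates the emptying instants are exactly the quotients
  \<open>q i / r i c\<close>, so the infimum is a minimum over a finite nonempty set and is
  attained.\<close>

lemma emptying_time:
  assumes "finite c" "c \<noteq> {}" and q: "\<And>i. i \<in> c \<Longrightarrow> 0 \<le> q i" and r: "\<And>i. i \<in> c \<Longrightarrow> 0 < r i c"
  shows "0 \<le> emptying_time r c q"
    and "\<And>i. i \<in> c \<Longrightarrow> r i c * emptying_time r c q \<le> q i"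
    and "\<exists>i\<in>c. r i c * emptying_time r c q = q i"
proof -
  have "{t. 0 \<le> t \<and> (\<exists>i\<in>c. q i - r i c * t = 0)} = (\<lambda>i. q i / r i c) ` c"
  proof (intro equalityI subsetI)
    fix t assume "t \<in> {t. 0 \<le> t \<and> (\<exists>i\<in>c. q i - r i c * t = 0)}"
    then obtain i where "i \<in> c" "q i = r i c * t" by auto
    with r[of i] show "t \<in> (\<lambda>i. q i / r i c) ` c" by (intro image_eqI[of _ _ i]) auto
  next
    fix t assume "t \<in> (\<lambda>i. q i / r i c) ` c"
    then obtain i where "i \<in> c" "t = q i / r i c" by blast
    with r[of i] q[of i] show "t \<in> {t. 0 \<le> t \<and> (\<exists>i\<in>c. q i - r i c * t = 0)}"
      by (auto intro!: bexI[of _ i])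
  qed
  then have eq: "emptying_time r c q = Min ((\<lambda>i. q i / r i c) ` c)"
    unfolding emptying_time_def using assms(1,2) by (simp add: cInf_eq_Min)
  have "emptying_time r c q \<in> (\<lambda>i. q i / r i c) ` c"
    unfolding eq using assms(1,2) by (intro Min_in) auto
  then obtain i where i: "i \<in> c" "emptying_time r c q = q i / r i c" by blast
  then show "0 \<le> emptying_time r c q" using q r by (simp add: less_imp_le)
  show "\<exists>i\<in>c. r i c * emptying_time r c q = q i" using i r[of i] by (intro bexI[of _ i]) auto
  fix j assume j: "j \<in> c"
  then have "emptying_time r c q \<le> q j / r j c" unfolding eq using assms(1) by (intro Min_le) auto
  then show "r j c * emptying_time r c q \<le> q j" using r[OF j] by (simp add: field_simps)
qed

lemma phase_group_subset: "phase_group N r d k \<subseteq> {1..N}"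
  by (auto simp: phase_group_def backlogged_def)

lemma phase_group_groups: "phase_group N r d k \<noteq> {} \<Longrightarrow> phase_group N r d k \<in> groups N"
  using phase_group_subset by (auto simp: groups_def)

lemma remaining_Suc:
  "remaining N r d (Suc k) i =
    (if phase_group N r d k = {} then remaining N r d k i
     else remaining N r d k i - r i (phase_group N r d k) * phase_duration N r d k)"
  by (simp add: phase_group_def phase_duration_def Let_def)

declare remaining.simps(2) [simp del]

text \<open>Positive rates inside each group make \<open>emptying_time\<close> meaningful, so that
  every phase with a nonempty group empties a queue.\<close>

locale positive_rates =
  fixes N :: nat and r :: "nat \<Rightarrow> nat set \<Rightarrow> real" and d :: "nat \<Rightarrow> real"
  assumes valid: "valid_rates N r"
    and rate_pos: "\<And>c i. c \<in> groups N \<Longrightarrow> i \<in> c \<Longrightarrow> 0 < r i c"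
    and demand_nonneg: "\<And>i. i \<in> {1..N} \<Longrightarrow> 0 \<le> d i"
begin

abbreviation "q \<equiv> remaining N r d"
abbreviation "c \<equiv> phase_group N r d"
abbreviation "t \<equiv> phase_duration N r d"

text \<open>A phase ends no later than any active queue empties, and an inactive link has rate
  0.\<close>

lemma remaining_nonneg: "i \<in> {1..N} \<Longrightarrow> 0 \<le> q k i"
proof (induction k arbitrary: i)
  case (Suc k)
  show ?case
  proof (cases "c k = {}")
    case False
    show ?thesis
    proof (cases "i \<in> c k")
      case True
      have "r i (c k) * t k \<le> q k i"
        unfolding phase_duration_def using False True Suc.IH phase_group_subset[of N r d k]
        by (intro emptying_time(2) rate_pos phase_group_groups)
          (auto intro: groups_finite[OF phase_group_groups])
      then show ?thesis using False by (simp add: remaining_Suc)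
    next
      case i: False
      have "r i (c k) = 0"
        using valid phase_group_groups[OF False] i Suc.prems unfolding valid_rates_def by blast
      then show ?thesis using Suc by (simp add: remaining_Suc)
    qed
  qed (use Suc in \<open>simp add: remaining_Suc\<close>)
qed (simp add: demand_nonneg)

lemma duration:
  assumes "c k \<noteq> {}"
  shows duration_nonneg: "0 \<le> t k" and duration_empties: "\<exists>i\<in>c k. r i (c k) * t k = q k i"
proof -
  have "finite (c k)" by (rule finite_subset[OF phase_group_subset]) simp
  moreover have "0 \<le> q k i" if "i \<in> c k" for i
    using that phase_group_subset[of N r d k] by (intro remaining_nonneg) auto
  ultimately show "0 \<le> t k" "\<exists>i\<in>c k. r i (c k) * t k = q k i"
    using emptying_time(1,3)[of "c k" "q k" r] assms rate_pos[OF phase_group_groups[OF assms]]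
    by (auto simp: phase_duration_def)
qed

lemma mem_phase_group: "i \<in> c k \<longleftrightarrow> i \<in> {1..N} \<and> 0 < q k i"
  by (auto simp: phase_group_def backlogged_def)

text \<open>Rates and durations are nonnegative, so no queue grows and an empty queue stays
  out.\<close>

lemma phase_group_Suc: "c (Suc k) \<subseteq> c k"
proof (cases "c k = {}")
  case True
  then have "q (Suc k) = q k" by (auto simp: remaining_Suc)
  then show ?thesis by (simp add: phase_group_def)
next
  case False
  show ?thesis
  proof
    fix i assume i: "i \<in> c (Suc k)"
    have "0 \<le> r i (c k)"
      using valid phase_group_groups[OF False] i mem_phase_group unfolding valid_rates_def by blast
    then have "q (Suc k) i \<le> q k i"
      using duration_nonneg[OF False] by (simp add: remaining_Suc)
    then show "i \<in> c k" using i by (simp add: mem_phase_group)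
  qed
qed

lemma phase_group_Suc_strict:
  assumes "c k \<noteq> {}"
  shows "c (Suc k) \<subset> c k"
proof -
  obtain i where "i \<in> c k" "r i (c k) * t k = q k i" using duration_empties[OF assms] by blast
  then have "i \<in> c k" "i \<notin> c (Suc k)" using assms by (simp_all add: mem_phase_group remaining_Suc)
  then show ?thesis using phase_group_Suc by blast
qed

lemma phase_group_antimono: "k \<le> l \<Longrightarrow> c l \<subseteq> c k"
  using phase_group_Suc by (rule lift_Suc_antimono_le)

text \<open>Each phase removes at least one link from the group. This bounds the number of phases by
  \<open>N\<close>.\<close>

lemma card_phase_group: "c k \<noteq> {} \<Longrightarrow> card (c k) + k \<le> N"
proof (induction k)
  case 0
  then show ?case using card_mono[OF _ phase_group_subset, of N r d 0] by simp
next
  case (Suc k)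
  then have ne: "c k \<noteq> {}" using phase_group_Suc[of k] by auto
  have "card (c (Suc k)) < card (c k)"
    using phase_group_Suc_strict[OF ne] groups_finite[OF phase_group_groups[OF ne]]
    by (simp add: psubset_card_mono)
  then show ?case using Suc.IH[OF ne] by simp
qed

lemma phase_group_less: "c k \<noteq> {} \<Longrightarrow> k < N"
  using card_phase_group[of k] groups_card[OF phase_group_groups, of N r d k] by auto

text \<open>Collecting the finitely many phases by their group turns a sum over groups into a sum
  over phases, where the telescoping recursion for the queues is available.\<close>

lemma sum_all_at_once:
  "(\<Sum>g\<in>groups N. f g * all_at_once N r d g) = (\<Sum>k | c k \<noteq> {}. f (c k) * t k)"
proof -
  have fin: "finite {k. c k \<noteq> {}}"
    by (rule finite_subset[of _ "{..<N}"]) (use phase_group_less in auto)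
  have "(\<Sum>g\<in>groups N. f g * all_at_once N r d g)
      = (\<Sum>g\<in>groups N. \<Sum>k\<in>{k \<in> {k. c k \<noteq> {}}. c k = g}. f (c k) * t k)"
    by (intro sum.cong refl) (auto simp: all_at_once_def sum_distrib_left groups_def intro!: sum.cong)
  also have "\<dots> = (\<Sum>k | c k \<noteq> {}. f (c k) * t k)"
    using fin by (intro sum.group finite_groups) (auto intro: phase_group_groups)
  finally show ?thesis .
qed

lemma is_schedule_all_at_once: "is_schedule N r d (all_at_once N r d)"
  unfolding is_schedule_def
proof (intro conjI ballI)
  fix g assume "g \<in> groups N"
  then show "0 \<le> all_at_once N r d g"
    unfolding all_at_once_def by (intro sum_nonneg duration_nonneg) (auto simp: groups_def)
next
  fix i assume i: "i \<in> {1..N}"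
  have "(\<Sum>g\<in>groups N. r i g * all_at_once N r d g) = (\<Sum>k | c k \<noteq> {}. r i (c k) * t k)"
    by (rule sum_all_at_once)
  also have "\<dots> = (\<Sum>k | c k \<noteq> {}. q k i - q (Suc k) i)"
    by (intro sum.cong) (auto simp: remaining_Suc)
  \<comment> \<open>Phases with an empty group leave the queues unchanged, so the added terms vanish
    and the sum telescopes.\<close>
  also have "\<dots> = (\<Sum>k<N. q k i - q (Suc k) i)"
    by (intro sum.mono_neutral_left) (use phase_group_less in \<open>auto simp: remaining_Suc\<close>)
  also have "\<dots> = q 0 i - q N i"
    by (rule sum_lessThan_telescope')
  \<comment> \<open>No group is left after \<open>N\<close> phases, so the queue is not positive; it
    is never negative either.\<close>
  also have "q N i = 0"
    using mem_phase_group[of i N] phase_group_less[of N] remaining_nonneg[OF i, of N] i by force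
  finally show "(\<Sum>g\<in>groups N. r i g * all_at_once N r d g) = d i" by simp
qed

text \<open>Each phase group is a superlevel set of the function \<open>f\<close> giving the number
  of phases in which a link is active. Sorting the links by decreasing \<open>f\<close> makes every
  such set a prefix, however ties are broken.\<close>

lemma prefix_order:
  obtains p where "bij_betw p {..<N} {1..N}"
    and "\<And>k. c k \<noteq> {} \<Longrightarrow> \<exists>m\<in>{1..N}. c k = p ` {..<m}"
proof -
  define f where "f i = (LEAST k. i \<notin> c k)" for i
  have f: "i \<in> c k \<longleftrightarrow> k < f i" for i k
  proof
    assume i: "i \<in> c k"
    \<comment> \<open>Phase \<open>N\<close> witnesses that the \<open>LEAST\<close> in
      \<open>f\<close> exists.\<close>
    have "i \<notin> c N" using phase_group_less[of N] by auto
    then have "i \<notin> c (f i)" unfolding f_def by (rule LeastI)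
    then show "k < f i" using i phase_group_antimono[of "f i" k] by force
  next
    show "k < f i \<Longrightarrow> i \<in> c k" unfolding f_def by (auto dest: not_less_Least)
  qed
  define xs where "xs = rev (sort_key f [1..<Suc N])"
  define p where "p = (!) xs"
  have xs: "distinct xs" "set xs = {1..N}" "length xs = N" by (auto simp: xs_def)
  have bij: "bij_betw p {..<N} {1..N}"
    unfolding p_def using xs by (metis bij_betw_nth)
  have anti: "f (p j) \<le> f (p i)" if "i \<le> j" "j < N" for i j
  proof -
    have "sorted (rev (map f xs))" by (simp add: xs_def rev_map)
    then show ?thesis using sorted_rev_nth_mono[of "map f xs" i j] that xs(3) by (simp add: p_def)
  qed
  have "\<exists>m\<in>{1..N}. c k = p ` {..<m}" if ne: "c k \<noteq> {}" for k
  proof -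
    define J where "J = {j. j < N \<and> k < f (p j)}"
    have J: "p ` J = c k"
    proof (intro equalityI subsetI)
      fix i assume i: "i \<in> c k"
      then have "i \<in> p ` {..<N}"
        using bij phase_group_subset[of N r d k] by (auto simp: bij_betw_def)
      with i show "i \<in> p ` J" by (auto simp: J_def f)
    qed (auto simp: J_def f)
    have "J \<noteq> {}" using J ne by blast
    have fin: "finite J" by (simp add: J_def)
    have Max: "Max J < N" "k < f (p (Max J))"
      using Max_in[OF fin \<open>J \<noteq> {}\<close>] J_def by blast+
    have "J \<subseteq> {..Max J}" using fin by auto
    \<comment> \<open>Since \<open>f\<close> decreases along \<open>p\<close>, the set
      \<open>J\<close> is downward closed.\<close>
    moreover have "{..Max J} \<subseteq> J"
    proof
      fix j assume "j \<in> {..Max J}"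
      then show "j \<in> J"
        using Max anti[of j "Max J"] unfolding J_def by simp
    qed
    ultimately have eq: "J = {..<Suc (Max J)}"
      unfolding lessThan_Suc_atMost by (rule equalityI)
    have "c k = p ` {..<Suc (Max J)}" using arg_cong[OF eq, of "(`) p"] J by simp
    then show ?thesis using Max(1) by (intro bexI[of _ "Suc (Max J)"]) auto
  qed
  with bij show ?thesis using that by blast
qed

end

theorem theorem11:
  fixes N :: nat
    and d :: "nat \<Rightarrow> real"
    and r :: "nat \<Rightarrow> nat set \<Rightarrow> real"
  assumes "1 \<le> N"
    and "\<forall>i\<in>{1..N}. 0 < d i"
    and "valid_rates N r"
    and "rate_monotone N r"
    and "\<forall>m\<in>{1..N}. 0 < r_max N r m \<and> 0 < r_min N r m"
    and "\<forall>m\<in>{2..N}. 1 / r_min N r m + (if m = 2 then 0 else 1 / r_min N r (m - 2))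
                     \<le> 2 / r_max N r (m - 1)"
  shows "optimal_schedule N r d (all_at_once N r d)"
proof -
  interpret positive_rates N r d
  proof
    show "0 < r i c" if "c \<in> groups N" "i \<in> c" for c i
      using rate_bounds(1)[OF that, of r] assms(5) groups_card[OF that(1)] by force
  qed (use assms in \<open>auto simp: less_imp_le\<close>)
  obtain p where p: "bij_betw p {..<N} {1..N}"
    and prefix: "\<And>k. phase_group N r d k \<noteq> {} \<Longrightarrow> \<exists>m\<in>{1..N}. phase_group N r d k = p ` {..<m}"
    using prefix_order by blast
  obtain w where le: "\<And>c. c \<in> groups N \<Longrightarrow> (\<Sum>i\<in>{1..N}. w i * r i c) \<le> 1"
    and eq: "\<And>m. m \<in> {1..N} \<Longrightarrow> (\<Sum>i\<in>{1..N}. w i * r i (p ` {..<m})) = 1"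
    using dual_weights[OF assms(3-6) p] by blast
  show ?thesis
  proof (rule optimal_scheduleI[OF is_schedule_all_at_once le])
    fix g assume g: "g \<in> groups N" "all_at_once N r d g \<noteq> 0"
    \<comment> \<open>A nonzero activation time is a sum over a nonempty set of phases, so
      \<open>g\<close> is a phase group and therefore a prefix, where the dual constraint is
      tight.\<close>
    then obtain k where "phase_group N r d k = g"
      unfolding all_at_once_def by (metis (mono_tags, lifting) mem_Collect_eq sum.neutral)
    then show "(\<Sum>i\<in>{1..N}. w i * r i g) = 1"
      using prefix[of k] eq g(1) by (auto simp: groups_def)
  qed
qed

end
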